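(* Let $Z$ be a unique factorization domain or a Dedekind domain, and let $Q$ be the fraction field of $Z$. Let $P_1(t),\ldots,P_\ell(t)\in Z[t]$ be $\ell\geq 2$ nonzero polynomials in one variable $t$, coprime in $Q[t]$ and such that no non-unit of $Z$ divides all values $P_1(z),\ldots,P_\ell(z)$ with $z\in Z$. Then there exists an element $m\in Z$ such that $P_1(m),\ldots,P_\ell(m)$ are coprime in $Z$.
   Context: Elements of an integral domain are coprime if they have no common divisor other than units. The hypothesis on values means: there is no non-unit $a\in Z$ such that $a$ divides $P_i(z)$ for all $i\in\{1,\ldots,\ell\}$ and all $z\in Z$. *)

theory Defs
  imports "HOL-Algebra.Algebraic_Closure_Type"
begin

text \<open>
  The domain \<open>Z\<close> is a type of class \<^class>\<open>idom\<close>, its fraction field \<open>Q\<close> is the type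
  of its fractions, and \<open>fract_poly\<close> is the inclusion of \<open>Z[t]\<close> into \<open>Q[t]\<close>. The locales of HOL-Algebra
  are applied to such a type through \<^const>\<open>ring_of_type_algebra\<close>.
\<close>

definition setwise_coprime :: "'a::idom set \<Rightarrow> bool" where
  "setwise_coprime A \<longleftrightarrow> (\<forall>d. (\<forall>a\<in>A. d dvd a) \<longrightarrow> d dvd 1)"

definition unique_factorization_domain :: "'a::idom itself \<Rightarrow> bool" where
  "unique_factorization_domain _ \<longleftrightarrow> factorial_domain (ring_of_type_algebra :: 'a ring)"

definition integrally_closed :: "'a::idom itself \<Rightarrow> bool" where
  "integrally_closed _ \<longleftrightarrow>
     (\<forall>x::'a fract. (\<exists>p::'a poly. Polynomial.lead_coeff p = 1 \<and> poly (fract_poly p) x = 0)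
        \<longrightarrow> x \<in> range to_fract)"

text \<open>Fields are not excluded: the last condition speaks of nonzero prime ideals only.\<close>

definition dedekind_domain :: "'a::idom itself \<Rightarrow> bool" where
  "dedekind_domain T \<longleftrightarrow>
     noetherian_domain (ring_of_type_algebra :: 'a ring) \<and>
     integrally_closed T \<and>
     (\<forall>I. primeideal I (ring_of_type_algebra :: 'a ring) \<and> I \<noteq> {0}
        \<longrightarrow> maximalideal I (ring_of_type_algebra :: 'a ring))"

end

theory Submission
  imports Defs
begin

text \<open>
  The polynomials being coprime over the fraction field, a combination of them with coefficients in
  \<open>Z[t]\<close> is a nonzero constant \<open>\<delta>\<close> (\<open>coprime_polys_nonzero_constant\<close>). Every common divisor of the values
  at a point divides \<open>\<delta>\<close>, so only finitely many prime ideals matter: those generated by the prime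
  divisors of \<open>\<delta>\<close> in a unique factorization domain, and those containing \<open>\<delta>\<close> in a Dedekind domain. It
  suffices to find a point that is good at each of these primes, in a sense that depends on the kind of
  domain.

  In a unique factorization domain, a point is good at \<open>p\<close> if some value there is not in \<open>p\<close>. In a
  Dedekind domain it is good at \<open>p\<close> if the values there have the least possible minimal valuation, so
  that locally at \<open>p\<close> one of them divides all values at all points. A common divisor of the values at a
  point that is good at all these primes then divides all values everywhere.

  Good points at different primes are combined in \<open>simultaneous_point\<close>, which needs two properties.
  Being good at \<open>p\<close> is stable under moving the point by multiples of a high power of an element of \<open>p\<close>.
  And for each \<open>b\<close> outside \<open>p\<close>, every residue class modulo \<open>b\<close> contains a point that is good at \<open>p\<close>. The
  second property holds if \<open>b\<close> is invertible modulo \<open>p\<close> (\<open>dense_of_inverse_mod\<close>), in particular for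
  maximal ideals. In a unique factorization domain with \<open>p\<close> not maximal, the domain of residues modulo
  \<open>p\<close> is infinite, and a polynomial function that is not identically zero on it has only finitely many
  zeros (\<open>dense_nonroots_of_noninvertible\<close>).

  The facts on Dedekind domains that are needed are proved directly from the definition: \<open>p\<close> is locally
  generated by one element (\<open>exists_uniformizer\<close>), which gives the valuation at \<open>p\<close>
  (\<open>local_factorization\<close>).
\<close>

section \<open>Ideals in terms of elements\<close>

abbreviation type_ring :: "'a::idom ring" where
  "type_ring \<equiv> ring_of_type_algebra"

lemma type_ring_simps [simp]:
  "carrier type_ring = UNIV"
  "x \<otimes>\<^bsub>type_ring\<^esub> y = x * y"
  "x \<oplus>\<^bsub>type_ring\<^esub> y = x + y"
  "\<one>\<^bsub>type_ring\<^esub> = 1"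
  "\<zero>\<^bsub>type_ring\<^esub> = 0"
  by (simp_all add: ring_of_type_algebra_def)

lemma ideal_type_ring_iff:
  fixes I :: "'a::idom set"
  shows "ideal I type_ring \<longleftrightarrow>
    0 \<in> I \<and> (\<forall>x\<in>I. \<forall>y\<in>I. x + y \<in> I) \<and> (\<forall>x\<in>I. \<forall>r. r * x \<in> I)"
proof
  assume "ideal I type_ring"
  then interpret ideal I "type_ring :: 'a ring" .
  show "0 \<in> I \<and> (\<forall>x\<in>I. \<forall>y\<in>I. x + y \<in> I) \<and> (\<forall>x\<in>I. \<forall>r. r * x \<in> I)"
    using I_l_closed additive_subgroup.zero_closed[OF is_additive_subgroup]
      additive_subgroup.a_closed[OF is_additive_subgroup] by auto
next
  assume I: "0 \<in> I \<and> (\<forall>x\<in>I. \<forall>y\<in>I. x + y \<in> I) \<and> (\<forall>x\<in>I. \<forall>r. r * x \<in> I)"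
  interpret R: ring "type_ring :: 'a ring" by (rule ring_from_type_algebra)
  show "ideal I type_ring"
  proof (rule idealI[OF R.ring_axioms])
    have "\<ominus>\<^bsub>type_ring\<^esub> x \<in> I" if "x \<in> I" for x
    proof -
      have "- x \<in> I" using I that by (metis mult_minus1)
      moreover have "\<ominus>\<^bsub>type_ring\<^esub> x = - x"
        by (rule R.minus_equality) simp_all
      ultimately show ?thesis by simp
    qed
    then show "subgroup I (add_monoid type_ring)"
      using I by (intro R.add.subgroupI) (auto simp: a_inv_def)
  qed (use I in \<open>auto simp: mult.commute\<close>)
qed

lemma primeideal_type_ring_iff:
  fixes I :: "'a::idom set"
  shows "primeideal I type_ring \<longleftrightarrow>
    ideal I type_ring \<and> 1 \<notin> I \<and> (\<forall>x y. x * y \<in> I \<longrightarrow> x \<in> I \<or> y \<in> I)"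
proof
  assume "primeideal I type_ring"
  then interpret primeideal I "type_ring :: 'a ring" .
  show "ideal I type_ring \<and> 1 \<notin> I \<and> (\<forall>x y. x * y \<in> I \<longrightarrow> x \<in> I \<or> y \<in> I)"
    using is_ideal I_prime I_notcarr one_imp_carrier by auto
next
  assume "ideal I type_ring \<and> 1 \<notin> I \<and> (\<forall>x y. x * y \<in> I \<longrightarrow> x \<in> I \<or> y \<in> I)"
  then show "primeideal I type_ring"
    by (intro primeidealI) auto
qed

context
  fixes I :: "'a::idom set"
  assumes I: "ideal I type_ring"
begin

lemma ideal_zero: "0 \<in> I"
  and ideal_add: "x \<in> I \<Longrightarrow> y \<in> I \<Longrightarrow> x + y \<in> I"
  and ideal_mult: "x \<in> I \<Longrightarrow> r * x \<in> I"
  using I by (auto simp: ideal_type_ring_iff)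

lemma ideal_mult': "x \<in> I \<Longrightarrow> x * r \<in> I"
  by (metis ideal_mult mult.commute)

lemma ideal_diff: "x \<in> I \<Longrightarrow> y \<in> I \<Longrightarrow> x - y \<in> I"
  by (metis ideal_add ideal_mult mult_minus1 uminus_add_conv_diff)

lemma ideal_dvd: "x \<in> I \<Longrightarrow> x dvd y \<Longrightarrow> y \<in> I"
  by (metis dvdE ideal_mult')

end

context
  fixes p :: "'a::idom set"
  assumes p: "primeideal p type_ring"
begin

lemma primeideal_ideal: "ideal p type_ring"
  and primeideal_one: "1 \<notin> p"
  and primeideal_multD: "x * y \<in> p \<Longrightarrow> x \<in> p \<or> y \<in> p"
  using p by (auto simp: primeideal_type_ring_iff)

lemma primeideal_mult_notin: "x \<notin> p \<Longrightarrow> y \<notin> p \<Longrightarrow> x * y \<notin> p"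
  using primeideal_multD by blast

lemma primeideal_power_notin: "x \<notin> p \<Longrightarrow> x ^ n \<notin> p"
  by (induction n) (use primeideal_one primeideal_mult_notin in auto)

lemma primeideal_prod_notin: "(\<And>i. i \<in> F \<Longrightarrow> f i \<notin> p) \<Longrightarrow> prod f F \<notin> p"
  by (induction F rule: infinite_finite_induct) (use primeideal_one primeideal_mult_notin in auto)

end

lemma ideal_adjoin:
  fixes I :: "'a::idom set"
  assumes "ideal I type_ring"
  shows "ideal {x + r * b |x r. x \<in> I} type_ring"
  unfolding ideal_type_ring_iff
proof (intro conjI ballI allI)
  show "0 \<in> {x + r * b |x r. x \<in> I}"
    using ideal_zero[OF assms] by (auto intro!: exI[of _ 0])
next
  fix u v assume "u \<in> {x + r * b |x r. x \<in> I}" "v \<in> {x + r * b |x r. x \<in> I}"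
  then obtain x r y s where "u = x + r * b" "v = y + s * b" "x \<in> I" "y \<in> I" by auto
  then have "u + v = (x + y) + (r + s) * b" "x + y \<in> I"
    using ideal_add[OF assms] by (simp_all add: algebra_simps)
  then show "u + v \<in> {x + r * b |x r. x \<in> I}" by blast
next
  fix u t assume "u \<in> {x + r * b |x r. x \<in> I}"
  then obtain x r where "u = x + r * b" "x \<in> I" by auto
  then have "t * u = t * x + (t * r) * b" by (simp add: algebra_simps)
  moreover have "t * x \<in> I" using \<open>x \<in> I\<close> by (rule ideal_mult[OF assms])
  ultimately show "t * u \<in> {x + r * b |x r. x \<in> I}" by blast
qed

text \<open>
  The quotient by a maximal ideal is a field, and this is the form in which that is used: \<open>b\<close> is
  invertible modulo \<open>p\<close>.
\<close>

lemma maximalideal_inverse_mod: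
  fixes p :: "'a::idom set"
  assumes p: "maximalideal p type_ring" and b: "b \<notin> p"
  shows "\<exists>r. 1 - b * r \<in> p"
proof -
  interpret maximalideal p "type_ring :: 'a ring" by fact
  let ?J = "{x + r * b |x r. x \<in> p}"
  have "p \<subseteq> ?J" by (force intro: exI[of _ 0])
  moreover have "b \<in> ?J" using ideal_zero[OF is_ideal] by (force intro: exI[of _ 1])
  ultimately have "?J = UNIV"
    using I_maximal[OF ideal_adjoin[OF is_ideal, of b]] b by auto
  then obtain x r where "1 = x + r * b" "x \<in> p" by blast
  then have "1 - b * r \<in> p" by (metis add_diff_cancel_right' mult.commute)
  then show ?thesis ..
qed

section \<open>A common point for finitely many prime ideals\<close>

text \<open>
  This takes the place of the Chinese remainder theorem, which fails for prime ideals that are not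
  comaximal, such as \<open>(x)\<close> and \<open>(y)\<close> in a polynomial ring. The set \<open>G p\<close> collects the points that
  are good at \<open>p\<close>. The primes are treated one after the other: since they are incomparable, there is
  some \<open>b\<close> outside the new prime \<open>p\<close> that lies in all the earlier ones. By stability, moving a point
  by a multiple of a high power of \<open>b\<close> keeps it good at the earlier primes, and by density one of
  these moves makes it good at \<open>p\<close>.
\<close>

lemma simultaneous_point:
  fixes S :: "'a::idom set set" and G :: "'a set \<Rightarrow> 'a set"
  assumes "finite S"
    and primes: "\<And>p. p \<in> S \<Longrightarrow> primeideal p type_ring"
    and incomparable: "\<And>p q. p \<in> S \<Longrightarrow> q \<in> S \<Longrightarrow> p \<subseteq> q \<Longrightarrow> p = q"
    and stable: "\<And>p m b. p \<in> S \<Longrightarrow> m \<in> G p \<Longrightarrow> b \<in> p \<Longrightarrow> \<exists>N. \<forall>y. m + b ^ N * y \<in> G p"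
    and dense: "\<And>p m b. p \<in> S \<Longrightarrow> b \<notin> p \<Longrightarrow> \<exists>y. m + b * y \<in> G p"
  shows "\<exists>m. \<forall>p\<in>S. m \<in> G p"
  using assms
proof (induction S rule: finite_induct)
  case empty
  then show ?case by simp
next
  case (insert p F)
  have "\<exists>m. \<forall>q\<in>F. m \<in> G q"
    by (rule insert.IH) (use insert.prems in auto)
  then obtain m where m: "q \<in> F \<Longrightarrow> m \<in> G q" for q by blast
  have p: "primeideal p type_ring" using insert.prems(1) by simp
  have "\<exists>e. e \<in> q \<and> e \<notin> p" if "q \<in> F" for q
    using insert.prems(2)[of q p] insert.hyps(2) that by auto
  then obtain e where e: "q \<in> F \<Longrightarrow> e q \<in> q" "q \<in> F \<Longrightarrow> e q \<notin> p" for q by metis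
  define b where "b = prod e F"
  have b_notin: "b \<notin> p"
    unfolding b_def by (rule primeideal_prod_notin[OF p]) (rule e(2))
  have b_in: "b \<in> q" if "q \<in> F" for q
  proof (rule ideal_dvd[OF primeideal_ideal])
    show "primeideal q type_ring" using insert.prems(1) that by simp
    show "e q \<in> q" using e that by blast
    show "e q dvd b" unfolding b_def using insert.hyps(1) that by (rule dvd_prodI)
  qed
  have "\<exists>N. \<forall>y. m + b ^ N * y \<in> G q" if "q \<in> F" for q
    using insert.prems(3)[of q m b] m b_in that by blast
  then obtain N where N: "q \<in> F \<Longrightarrow> m + b ^ N q * y \<in> G q" for q y by metis
  define M where "M = sum N F"
  obtain y where y: "m + b ^ M * y \<in> G p"
    using insert.prems(4)[of p "b ^ M" m] primeideal_power_notin[OF p b_notin] by blast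
  have "m + b ^ M * y \<in> G q" if "q \<in> F" for q
  proof -
    have "N q \<le> M" unfolding M_def using insert.hyps(1) that by (simp add: member_le_sum)
    then have "b ^ M * y = b ^ N q * (b ^ (M - N q) * y)"
      by (metis le_add_diff_inverse mult.assoc power_add)
    then show ?thesis using N[OF that] by metis
  qed
  then show ?case using y by auto
qed

text \<open>
  Density is automatic where \<open>b\<close> is invertible modulo \<open>p\<close>. Then \<open>b\<close> is invertible modulo every power
  of \<open>1 - b * r\<close>, so some \<open>m + b * y\<close> can be made congruent to the good point \<open>z\<close> modulo such a power.
\<close>

lemma dense_of_inverse_mod:
  fixes p G :: "'a::idom set"
  assumes p: "ideal p type_ring" and r: "1 - b * r \<in> p"
    and z: "z \<in> G"
    and stable: "\<And>m c. m \<in> G \<Longrightarrow> c \<in> p \<Longrightarrow> \<exists>N. \<forall>y. m + c ^ N * y \<in> G"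
  shows "\<exists>y. m + b * y \<in> G"
proof -
  obtain N where N: "\<And>y. z + (1 - b * r) ^ N * y \<in> G" using stable[OF z r] by blast
  \<comment> \<open>The cofactor is an inverse of \<open>b\<close> modulo the power.\<close>
  have "b dvd 1 - (1 - b * r) ^ N"
    unfolding one_diff_power_eq by simp
  then obtain t where t: "1 - (1 - b * r) ^ N = b * t" ..
  have "m + b * (t * (z - m)) = m + (1 - (1 - b * r) ^ N) * (z - m)"
    by (simp add: t mult.assoc)
  also have "\<dots> = z + (1 - b * r) ^ N * (m - z)" by (simp add: algebra_simps)
  finally show ?thesis using N by metis
qed

section \<open>Polynomial values modulo a prime ideal\<close>

lemma poly_diff_dvd: "x - y dvd poly f x - poly (f :: 'a::idom poly) y"
proof (induction f)
  case (pCons a f)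
  have "poly (pCons a f) x - poly (pCons a f) y
      = x * (poly f x - poly f y) + (x - y) * poly f y"
    by (simp add: algebra_simps)
  then show ?case using pCons by auto
qed simp

text \<open>
  Over the domain of residues modulo \<open>p\<close>, a polynomial with infinitely many roots is zero. The proof
  divides out one root at a time, which avoids forming the residue ring.
\<close>

lemma poly_in_primeideal_of_incongruent_roots:
  fixes f :: "'a::idom poly" and x :: "nat \<Rightarrow> 'a"
  assumes p: "primeideal p type_ring"
    and "\<And>i j. i \<noteq> j \<Longrightarrow> x i - x j \<notin> p"
    and "\<And>k. poly f (x k) \<in> p"
  shows "poly f z \<in> p"
  using assms(2,3)
proof (induction "Polynomial.degree f" arbitrary: f x)
  case 0
  then obtain c where "f = [:c:]" by (metis degree_eq_zeroE)
  then show ?case using 0(3) by simp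
next
  case (Suc n)
  note idl = primeideal_ideal[OF p]
  define g where "g = synthetic_div f (x 0)"
  have f: "poly f w = (w - x 0) * poly g w + poly f (x 0)" for w
  proof -
    have "poly f w = poly ([:- x 0, 1:] * g + [:poly f (x 0):]) w"
      unfolding g_def by (simp only: synthetic_div_correct')
    then show ?thesis by (simp add: algebra_simps)
  qed
  have "poly g z \<in> p"
  proof (rule Suc.hyps(1)[of g "\<lambda>k. x (Suc k)"])
    show "n = Polynomial.degree g"
      unfolding g_def degree_synthetic_div using Suc.hyps(2) by simp
    show "x (Suc i) - x (Suc j) \<notin> p" if "i \<noteq> j" for i j
      using Suc.prems(1) that by simp
    show "poly g (x (Suc k)) \<in> p" for k
    proof -
      have "(x (Suc k) - x 0) * poly g (x (Suc k)) = poly f (x (Suc k)) - poly f (x 0)"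
        using f[of "x (Suc k)"] by simp
      also have "\<dots> \<in> p" using Suc.prems(2) ideal_diff[OF idl] by blast
      finally show ?thesis using primeideal_multD[OF p] Suc.prems(1)[of "Suc k" 0] by blast
    qed
  qed
  then show ?case
    using f[of z] Suc.prems(2) ideal_add[OF idl] ideal_mult[OF idl] by metis
qed

text \<open>
  If some \<open>r\<close> is neither zero nor invertible modulo \<open>p\<close>, its powers are pairwise incongruent. So the
  points \<open>m + b * r ^ k\<close> fill infinitely many residue classes, and they cannot all be roots of a
  polynomial that has a nonzero value modulo \<open>p\<close>.
\<close>

lemma dense_nonroots_of_noninvertible:
  fixes f :: "'a::idom poly"
  assumes p: "primeideal p type_ring" and z: "poly f z \<notin> p"
    and r: "r \<notin> p" "\<And>s. 1 - r * s \<notin> p" and b: "b \<notin> p"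
  shows "\<exists>y. poly f (m + b * y) \<notin> p"
proof (rule ccontr)
  assume "\<not> ?thesis"
  then have roots: "poly f (m + b * r ^ k) \<in> p" for k by blast
  have lt: "(m + b * r ^ i) - (m + b * r ^ j) \<notin> p" if "i < j" for i j
  proof -
    obtain k where j: "j = i + Suc k" using \<open>i < j\<close> less_iff_Suc_add by auto
    have "(m + b * r ^ i) - (m + b * r ^ j) = b * r ^ i * (1 - r * r ^ k)"
      unfolding j by (simp add: algebra_simps power_add)
    then show ?thesis
      using r b primeideal_mult_notin[OF p] primeideal_power_notin[OF p] by metis
  qed
  have "(m + b * r ^ i) - (m + b * r ^ j) \<notin> p" if "i \<noteq> j" for i j
  proof (cases "i < j")
    case False
    then have "(m + b * r ^ j) - (m + b * r ^ i) \<notin> p" using lt that by simp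
    moreover have "(m + b * r ^ j) - (m + b * r ^ i) = - 1 * ((m + b * r ^ i) - (m + b * r ^ j))"
      by simp
    ultimately show ?thesis using ideal_mult[OF primeideal_ideal[OF p]] by metis
  qed (rule lt)
  then have "poly f z \<in> p"
    using poly_in_primeideal_of_incongruent_roots[OF p, of "\<lambda>k. m + b * r ^ k"] roots by blast
  with z show False ..
qed

section \<open>The constant in the ideal of the polynomials\<close>

text \<open>
  A Bezout relation with its denominators cleared. A nonzero polynomial \<open>g\<close> of least degree among the
  combinations of the \<open>P i\<close> with coefficients in \<open>Z[t]\<close> leaves pseudo-remainder zero on each \<open>P i\<close>.
  Over the fraction field it is thus a common divisor, hence a unit, so \<open>g\<close> is a constant.
\<close>

lemma coprime_polys_nonzero_constant:
  fixes P :: "'i \<Rightarrow> 'a::idom poly"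
  assumes "finite J" "i0 \<in> J" "P i0 \<noteq> 0"
    and coprime: "setwise_coprime ((\<lambda>i. fract_poly (P i)) ` J)"
  shows "\<exists>A \<delta>. \<delta> \<noteq> 0 \<and> (\<Sum>i\<in>J. A i * P i) = [:\<delta>:]"
proof -
  define comb where "comb f \<longleftrightarrow> (\<exists>A. f = (\<Sum>i\<in>J. A i * P i))" for f
  have comb_gen: "comb (P i)" if "i \<in> J" for i
    unfolding comb_def using \<open>finite J\<close> that
    by (intro exI[of _ "\<lambda>j. if j = i then 1 else 0"])
       (simp add: if_distrib[of "\<lambda>x. x * _"] cong: if_cong)
  have comb_lin: "comb (u * f - v * g)" if "comb f" "comb g" for f g u v
  proof -
    from that obtain A B where "f = (\<Sum>i\<in>J. A i * P i)" "g = (\<Sum>i\<in>J. B i * P i)"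
      unfolding comb_def by blast
    then have "u * f - v * g = (\<Sum>i\<in>J. (u * A i - v * B i) * P i)"
      by (simp add: sum_distrib_left sum_subtractf algebra_simps)
    then show ?thesis unfolding comb_def by (rule exI[of _ "\<lambda>i. u * A i - v * B i"])
  qed
  obtain g where g: "comb g" "g \<noteq> 0"
    and min: "\<And>f. comb f \<Longrightarrow> f \<noteq> 0 \<Longrightarrow> Polynomial.degree g \<le> Polynomial.degree f"
    using ex_has_least_nat[of "\<lambda>f. comb f \<and> f \<noteq> 0" "P i0" Polynomial.degree]
      comb_gen[OF assms(2)] assms(3) by blast
  have "fract_poly g dvd fract_poly (P i)" if i: "i \<in> J" for i
  proof -
    obtain a q where aq: "a \<noteq> 0" "smult a (P i) = g * q + pseudo_mod (P i) g"
      and deg: "pseudo_mod (P i) g = 0 \<or> Polynomial.degree (pseudo_mod (P i) g) < Polynomial.degree g"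
      using pseudo_mod[OF g(2)] by blast
    have "pseudo_mod (P i) g = [:a:] * P i - q * g" using aq(2) by simp
    then have "comb (pseudo_mod (P i) g)" using comb_lin comb_gen[OF i] g(1) by metis
    with min deg have "pseudo_mod (P i) g = 0" by fastforce
    with aq have "smult (to_fract a) (fract_poly (P i)) = fract_poly g * fract_poly q"
      by (metis add.right_neutral fract_poly_mult fract_poly_smult)
    then have "fract_poly g dvd smult (to_fract a) (fract_poly (P i))" by simp
    then show ?thesis using aq(1) by (simp add: dvd_smult_iff)
  qed
  then have "fract_poly g dvd 1"
    using coprime unfolding setwise_coprime_def by blast
  then have "Polynomial.degree (fract_poly g) = 0" by (auto simp: is_unit_poly_iff)
  then have "Polynomial.degree g = 0" by (simp add: degree_map_poly)
  then obtain \<delta> where "g = [:\<delta>:]" by (metis degree_eq_zeroE)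
  then show ?thesis using g unfolding comb_def by (metis pCons_eq_0_iff)
qed

section \<open>Unique factorization domains\<close>

lemma ufd_prime_factorization:
  fixes x :: "'a::idom"
  assumes "unique_factorization_domain TYPE('a)" and "x \<noteq> 0"
  shows "\<exists>fs. (\<forall>f\<in>set fs. prime_elem f) \<and> prod_list fs dvd x \<and> x dvd prod_list fs"
proof -
  interpret factorial_domain "type_ring :: 'a ring"
    using assms(1) unfolding unique_factorization_domain_def .
  let ?M = "mult_of (type_ring :: 'a ring)"
  have dvd_iff: "a divides\<^bsub>?M\<^esub> b \<longleftrightarrow> a dvd b" if "a \<noteq> 0" "b \<noteq> 0" for a b
    using that unfolding factor_def dvd_def by auto
  have Units_iff: "u \<in> Units ?M \<longleftrightarrow> u dvd 1" for u
    using divides_one[of u] unfolding Units_mult_eq_Units factor_def dvd_def by auto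
  show ?thesis
  proof (cases "x dvd 1")
    case True
    then show ?thesis by (auto intro: exI[of _ "[]"])
  next
    case False
    then obtain fs where fs: "set fs \<subseteq> carrier ?M" "factors ?M fs x"
      using factors_exist[of x] assms(2) Units_iff by auto
    have "prime_elem f" if "f \<in> set fs" for f
    proof -
      have "f \<noteq> 0" using fs(1) that by auto
      have "Divisibility.prime ?M f"
        using irreducible_prime[of f] fs that unfolding factors_def by auto
      then have "\<not> f dvd 1"
        and mult: "a \<noteq> 0 \<Longrightarrow> b \<noteq> 0 \<Longrightarrow> f dvd a * b \<Longrightarrow> f dvd a \<or> f dvd b" for a b
        using \<open>f \<noteq> 0\<close> unfolding Divisibility.prime_def Units_iff by (auto simp: dvd_iff)
      show ?thesis
      proof (rule prime_elemI)
        show "f dvd a \<or> f dvd b" if "f dvd a * b" for a b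
          using mult[OF _ _ that] by (cases "a = 0 \<or> b = 0") auto
      qed (use \<open>f \<noteq> 0\<close> \<open>\<not> f dvd 1\<close> in auto)
    qed
    moreover have "foldr (\<otimes>\<^bsub>?M\<^esub>) fs \<one>\<^bsub>?M\<^esub> = prod_list fs"
      by (induction fs) auto
    then have "prod_list fs = x" using fs(2) unfolding factors_def by metis
    ultimately show ?thesis by (metis dvd_refl)
  qed
qed

lemma primeideal_of_prime_elem:
  assumes "prime_elem (p :: 'a::idom)"
  shows "primeideal {x. p dvd x} type_ring"
  using assms prime_elem_dvd_mult_iff[OF assms] prime_elem_not_unit[OF assms]
  by (auto simp: primeideal_type_ring_iff ideal_type_ring_iff)

text \<open>
  This makes the ideals generated by prime elements incomparable unless they are equal.
\<close>

lemma prime_elem_dvd_prime_elem: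
  fixes p q :: "'a::idom"
  assumes "prime_elem p" "prime_elem q" "p dvd q"
  shows "q dvd p"
proof -
  obtain k where k: "q = p * k" using assms(3) ..
  then consider "q dvd p" | "q dvd k"
    using prime_elem_dvd_multD[OF assms(2), of p k] by auto
  then show ?thesis
  proof cases
    case 2
    then obtain j where "k = q * j" ..
    with k have "q * (p * j) = q * 1" by simp
    then have "p * j = 1" using assms(2) by (auto simp: prime_elem_def)
    then have "p dvd 1" by (metis dvd_triv_left)
    then show ?thesis using assms(1) by (auto simp: prime_elem_def)
  qed
qed

lemma prime_elem_dvd_prod_listD:
  assumes "prime_elem (p :: 'a::idom)" "p dvd prod_list fs"
  shows "\<exists>f\<in>set fs. p dvd f"
  using assms(2)
proof (induction fs)
  case Nil
  then show ?case using prime_elem_not_unit[OF assms(1)] by simp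
qed (use prime_elem_dvd_multD[OF assms(1)] in auto)

text \<open>
  Ideals are counted instead of elements, because a prime element has as many associates as there are
  units.
\<close>

lemma ufd_finite_prime_divisors:
  fixes \<delta> :: "'a::idom"
  assumes "unique_factorization_domain TYPE('a)" "\<delta> \<noteq> 0"
  shows "finite {{x. p dvd x} |p. prime_elem p \<and> p dvd \<delta>}"
proof -
  obtain fs where fs: "\<And>f. f \<in> set fs \<Longrightarrow> prime_elem f" "\<delta> dvd prod_list fs"
    using ufd_prime_factorization[OF assms] by blast
  have "{{x. p dvd x} |p. prime_elem p \<and> p dvd \<delta>} \<subseteq> (\<lambda>f. {x. f dvd x}) ` set fs"
  proof clarify
    fix p assume p: "prime_elem p" "p dvd \<delta>"
    then obtain f where "f \<in> set fs" "p dvd f"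
      using prime_elem_dvd_prod_listD dvd_trans fs(2) by metis
    moreover from this have "f dvd p" using prime_elem_dvd_prime_elem p fs(1) by metis
    ultimately show "{x. p dvd x} \<in> (\<lambda>f. {x. f dvd x}) ` set fs"
      by (auto intro!: image_eqI[of _ _ f] dest: dvd_trans)
  qed
  then show ?thesis by (rule finite_subset) simp
qed

lemma ufd_exists_prime_divisor:
  fixes d :: "'a::idom"
  assumes "unique_factorization_domain TYPE('a)" "d \<noteq> 0" "\<not> d dvd 1"
  shows "\<exists>p. prime_elem p \<and> p dvd d"
proof -
  obtain fs where fs: "\<And>f. f \<in> set fs \<Longrightarrow> prime_elem f" "d dvd prod_list fs" "prod_list fs dvd d"
    using ufd_prime_factorization[OF assms(1,2)] by blast
  show ?thesis
  proof (cases fs)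
    case Nil
    with fs(2) assms(3) show ?thesis by simp
  next
    case (Cons f gs)
    with fs(3) have "f dvd d" by (simp add: dvd_mult_left)
    with fs(1)[of f] Cons show ?thesis by auto
  qed
qed

text \<open>
  Here a point is good at the prime ideal \<open>p\<close> if the values there do not all lie in \<open>p\<close>. The hypothesis
  on divisors provides a good point at each \<open>p\<close>. Density follows because either every element outside
  \<open>p\<close> is invertible modulo \<open>p\<close>, or the residue ring is infinite and nonroots are plentiful. At a point
  that is good at all primes dividing \<open>\<delta>\<close>, a nonunit common divisor of the values would divide \<open>\<delta>\<close> and
  so have a prime factor among these primes.
\<close>

proposition ufd_coprime_values:
  fixes P :: "'i \<Rightarrow> 'a::idom poly"
  assumes ufd: "unique_factorization_domain TYPE('a)"
    and "\<delta> \<noteq> 0" and bezout: "(\<Sum>i\<in>J. A i * P i) = [:\<delta>:]"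
    and no_divisor: "\<And>a. (\<And>i z. i \<in> J \<Longrightarrow> a dvd poly (P i) z) \<Longrightarrow> a dvd 1"
  shows "\<exists>m. setwise_coprime ((\<lambda>i. poly (P i) m) ` J)"
proof -
  define S where "S = {{x. p dvd x} |p. prime_elem p \<and> p dvd \<delta>}"
  define G where "G p = {m. \<exists>i\<in>J. poly (P i) m \<notin> p}" for p
  have prime: "primeideal p type_ring" if "p \<in> S" for p
    using that primeideal_of_prime_elem unfolding S_def by blast
  have stable: "m + b * y \<in> G p" if "p \<in> S" "m \<in> G p" "b \<in> p" for p m b y
  proof -
    note idl = primeideal_ideal[OF prime[OF \<open>p \<in> S\<close>]]
    obtain i where i: "i \<in> J" "poly (P i) m \<notin> p" using \<open>m \<in> G p\<close> unfolding G_def by blast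
    have "(m + b * y) - m dvd poly (P i) (m + b * y) - poly (P i) m" by (rule poly_diff_dvd)
    then have "poly (P i) (m + b * y) - poly (P i) m \<in> p"
      using ideal_dvd[OF idl \<open>b \<in> p\<close>] by (metis add_diff_cancel_left' dvd_mult_left)
    then have "poly (P i) (m + b * y) \<notin> p"
      using i(2) ideal_diff[OF idl] by (metis diff_diff_eq2 add_diff_cancel_left')
    with i(1) show ?thesis unfolding G_def by blast
  qed
  have "\<exists>m. \<forall>p\<in>S. m \<in> G p"
  proof (rule simultaneous_point)
    show "finite S" unfolding S_def by (rule ufd_finite_prime_divisors) fact+
    show "p = q" if "p \<in> S" "q \<in> S" "p \<subseteq> q" for p q
    proof -
      obtain a where a: "prime_elem a" "p = {x. a dvd x}" using \<open>p \<in> S\<close> unfolding S_def by blast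
      obtain b where b: "prime_elem b" "q = {x. b dvd x}" using \<open>q \<in> S\<close> unfolding S_def by blast
      note ab = a b
      then have "b dvd a" using that(3) by auto
      then have "a dvd b" using prime_elem_dvd_prime_elem ab by blast
      with \<open>b dvd a\<close> show ?thesis unfolding ab by (auto dest: dvd_trans)
    qed
    show "\<exists>N. \<forall>y. m + b ^ N * y \<in> G p" if "p \<in> S" "m \<in> G p" "b \<in> p" for p m b
      using stable[OF that] by (intro exI[of _ 1]) simp
    show "\<exists>y. m + b * y \<in> G p" if p: "p \<in> S" and b: "b \<notin> p" for p m b
    proof -
      obtain a where a: "prime_elem a" "p = {x. a dvd x}" using p unfolding S_def by blast
      then obtain i z where iz: "i \<in> J" "poly (P i) z \<notin> p"
        using no_divisor[of a] prime_elem_not_unit[OF a(1)] by blast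
      show ?thesis
      proof (cases "\<exists>r. r \<notin> p \<and> (\<forall>s. 1 - r * s \<notin> p)")
        case True
        then show ?thesis
          using dense_nonroots_of_noninvertible[OF prime[OF p] iz(2) _ _ b] iz(1)
          unfolding G_def by blast
      next
        case False
        then obtain s where s: "1 - b * s \<in> p" using b by blast
        have "z \<in> G p" using iz unfolding G_def by blast
        then show ?thesis
        proof (rule dense_of_inverse_mod[OF primeideal_ideal[OF prime[OF p]] s])
          show "\<exists>N. \<forall>y. m + c ^ N * y \<in> G p" if "m \<in> G p" "c \<in> p" for m c
            using stable[OF p that] by (intro exI[of _ 1]) simp
        qed
      qed
    qed
  qed (rule prime)
  then obtain m where m: "\<And>p. p \<in> S \<Longrightarrow> m \<in> G p" by blast
  have "setwise_coprime ((\<lambda>i. poly (P i) m) ` J)"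
    unfolding setwise_coprime_def
  proof (intro allI impI)
    fix d assume d: "\<forall>v\<in>(\<lambda>i. poly (P i) m) ` J. d dvd v"
    have "\<delta> = (\<Sum>i\<in>J. poly (A i) m * poly (P i) m)"
      using arg_cong[OF bezout, of "\<lambda>f. poly f m"] by (simp add: poly_sum)
    then have "d dvd \<delta>" using d by (simp add: dvd_sum)
    show "d dvd 1"
    proof (rule ccontr)
      assume "\<not> d dvd 1"
      moreover have "d \<noteq> 0" using \<open>d dvd \<delta>\<close> \<open>\<delta> \<noteq> 0\<close> by auto
      ultimately obtain p where p: "prime_elem p" "p dvd d"
        using ufd_exists_prime_divisor[OF ufd] by blast
      then have "{x. p dvd x} \<in> S"
        using \<open>d dvd \<delta>\<close> unfolding S_def by (blast intro: dvd_trans)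
      then have "m \<in> G {x. p dvd x}" by (rule m)
      then show False using d p(2) unfolding G_def by (auto dest: dvd_trans)
    qed
  qed
  then show ?thesis ..
qed

section \<open>Noetherian domains\<close>

lemma noetherian_maximal_element:
  fixes F :: "'a::idom set set"
  assumes "noetherian_domain (type_ring :: 'a ring)"
    and "F \<noteq> {}" and ideals: "\<And>I. I \<in> F \<Longrightarrow> ideal I type_ring"
  obtains M where "M \<in> F" "\<And>I. I \<in> F \<Longrightarrow> M \<subseteq> I \<Longrightarrow> I = M"
proof -
  have "\<exists>M\<in>F. \<forall>I\<in>F. M \<subseteq> I \<longrightarrow> I = M"
  proof (rule subset_Zorn_nonempty[OF assms(2)])
    fix C assume C: "C \<noteq> {}" "subset.chain F C"
    interpret noetherian_domain "type_ring :: 'a ring" by fact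
    have "subset.chain {I. ideal I type_ring} C"
      using C(2) ideals unfolding pred_on.chain_def by blast
    then have "\<Union>C \<in> C" using ideal_chain_is_trivial C(1) by blast
    then show "\<Union>C \<in> F" using C(2) unfolding pred_on.chain_def by blast
  qed
  then show thesis using that by metis
qed

lemma noetherian_ideal_sequence_stationary:
  fixes J :: "nat \<Rightarrow> 'a::idom set"
  assumes "noetherian_domain (type_ring :: 'a ring)"
    and "\<And>n. ideal (J n) type_ring" and "\<And>n. J n \<subseteq> J (Suc n)"
  shows "\<exists>n. J (Suc n) = J n"
proof -
  obtain M where M: "M \<in> range J" "\<And>I. I \<in> range J \<Longrightarrow> M \<subseteq> I \<Longrightarrow> I = M"
    by (rule noetherian_maximal_element[OF assms(1), of "range J"]) (use assms(2) in auto)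
  then obtain n where "M = J n" by blast
  then have "J (Suc n) = J n" using M(2)[of "J (Suc n)"] assms(3) by simp
  then show ?thesis ..
qed

lemma noetherian_proper_ideal_in_primeideal:
  fixes I :: "'a::idom set"
  assumes noeth: "noetherian_domain (type_ring :: 'a ring)"
    and I: "ideal I type_ring" "1 \<notin> I"
  shows "\<exists>p. primeideal p type_ring \<and> I \<subseteq> p"
proof -
  define F where "F = {K. ideal K type_ring \<and> 1 \<notin> K \<and> I \<subseteq> K}"
  have "I \<in> F" using I unfolding F_def by simp
  then have "F \<noteq> {}" by auto
  then obtain M where M: "M \<in> F" and max: "\<And>K. K \<in> F \<Longrightarrow> M \<subseteq> K \<Longrightarrow> K = M"
    by (rule noetherian_maximal_element[OF noeth]) (auto simp: F_def)
  have "maximalideal M type_ring"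
  proof (rule maximalidealI)
    fix K assume K: "ideal K (type_ring :: 'a ring)" "M \<subseteq> K"
    show "K = M \<or> K = carrier type_ring"
    proof (cases "1 \<in> K")
      case True
      then show ?thesis using ideal.one_imp_carrier[OF K(1)] by simp
    next
      case False
      then have "K \<in> F" using M K unfolding F_def by auto
      then show ?thesis using max K(2) by simp
    qed
  qed (use M in \<open>auto simp: F_def\<close>)
  then have "primeideal M type_ring"
    by (rule cring.maximalideal_prime[OF cring_from_type_algebra])
  then show ?thesis using M unfolding F_def by blast
qed

text \<open>
  The finiteness of the set of minimal primes over an ideal, by Noetherian induction: a largest
  counterexample \<open>K\<close> is not prime, so it contains a product \<open>x * y\<close> of two elements outside it, and
  every prime over \<open>K\<close> lies over \<open>K + (x)\<close> or over \<open>K + (y)\<close>.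
\<close>

lemma noetherian_finite_primes_below:
  fixes I :: "'a::idom set"
  assumes noeth: "noetherian_domain (type_ring :: 'a ring)"
    and "ideal I type_ring"
  shows "\<exists>F. finite F \<and> (\<forall>q\<in>F. primeideal q type_ring \<and> I \<subseteq> q) \<and>
    (\<forall>p. primeideal p type_ring \<and> I \<subseteq> p \<longrightarrow> (\<exists>q\<in>F. q \<subseteq> p))"
proof (rule ccontr)
  define good where "good I \<longleftrightarrow> (\<exists>F. finite F \<and> (\<forall>q\<in>F. primeideal q type_ring \<and> I \<subseteq> q) \<and>
    (\<forall>p. primeideal p type_ring \<and> I \<subseteq> p \<longrightarrow> (\<exists>q\<in>F. q \<subseteq> p)))" for I :: "'a set"
  have goodI: "good I" if "finite F" "\<And>q. q \<in> F \<Longrightarrow> primeideal q type_ring \<and> I \<subseteq> q"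
    "\<And>p. primeideal p type_ring \<Longrightarrow> I \<subseteq> p \<Longrightarrow> \<exists>q\<in>F. q \<subseteq> p" for F I
    unfolding good_def by (intro exI[of _ F] conjI) (use that in auto)
  assume "\<not> ?thesis"
  then have "\<not> good I" unfolding good_def .
  with assms(2) have "{I. ideal I type_ring \<and> \<not> good I} \<noteq> {}" by auto
  then obtain K where "K \<in> {I. ideal I type_ring \<and> \<not> good I}"
    and max: "\<And>L. L \<in> {I. ideal I type_ring \<and> \<not> good I} \<Longrightarrow> K \<subseteq> L \<Longrightarrow> L = K"
    by (rule noetherian_maximal_element[OF noeth]) auto
  then have idl: "ideal K type_ring" and bad: "\<not> good K" by auto
  have "1 \<notin> K"
  proof
    assume "1 \<in> K"
    then have "good K" using primeideal_one by (intro goodI[of "{}"]) auto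
    with bad show False ..
  qed
  moreover have "\<not> primeideal K type_ring"
  proof
    assume "primeideal K type_ring"
    then have "good K" by (intro goodI[of "{K}"]) auto
    with bad show False ..
  qed
  ultimately obtain x y where xy: "x * y \<in> K" "x \<notin> K" "y \<notin> K"
    unfolding primeideal_type_ring_iff using idl by auto
  define adj where "adj b = {u + r * b |u r. u \<in> K}" for b
  have sub: "K \<subseteq> adj b" for b unfolding adj_def by (force intro: exI[of _ 0])
  have mem: "b \<in> adj b" for b
    using ideal_zero[OF idl] unfolding adj_def by (force intro: exI[of _ 1])
  have adj: "good (adj b)" if "b \<notin> K" for b
  proof (rule ccontr)
    assume "\<not> good (adj b)"
    then have "adj b = K"
      using max[of "adj b"] sub ideal_adjoin[OF idl, of b] unfolding adj_def by simp
    then show False using mem[of b] that by simp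
  qed
  obtain Fx where Fx: "finite Fx" "\<And>q. q \<in> Fx \<Longrightarrow> primeideal q type_ring \<and> adj x \<subseteq> q"
    "\<And>p. primeideal p type_ring \<Longrightarrow> adj x \<subseteq> p \<Longrightarrow> \<exists>q\<in>Fx. q \<subseteq> p"
    using adj[OF xy(2)] unfolding good_def by metis
  obtain Fy where Fy: "finite Fy" "\<And>q. q \<in> Fy \<Longrightarrow> primeideal q type_ring \<and> adj y \<subseteq> q"
    "\<And>p. primeideal p type_ring \<Longrightarrow> adj y \<subseteq> p \<Longrightarrow> \<exists>q\<in>Fy. q \<subseteq> p"
    using adj[OF xy(3)] unfolding good_def by metis
  have "good K"
  proof (rule goodI[of "Fx \<union> Fy"])
    show "finite (Fx \<union> Fy)" using Fx(1) Fy(1) by simp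
    show "primeideal q type_ring \<and> K \<subseteq> q" if "q \<in> Fx \<union> Fy" for q
      using that Fx(2)[of q] Fy(2)[of q] sub by auto
    fix p :: "'a set" assume p: "primeideal p type_ring" "K \<subseteq> p"
    note pidl = primeideal_ideal[OF p(1)]
    have "adj b \<subseteq> p" if "b \<in> p" for b
      using that p(2) ideal_add[OF pidl] ideal_mult[OF pidl] unfolding adj_def by auto
    moreover have "x \<in> p \<or> y \<in> p" using primeideal_multD[OF p(1)] xy(1) p(2) by auto
    ultimately show "\<exists>q\<in>Fx \<union> Fy. q \<subseteq> p" using Fx(3)[OF p(1)] Fy(3)[OF p(1)] by auto
  qed
  with bad show False ..
qed

section \<open>Local structure of Dedekind domains\<close>

lemma ideal_quotient:
  fixes a b :: "'a::idom"
  shows "ideal {x. a dvd x * b} type_ring"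
  by (auto simp: ideal_type_ring_iff distrib_right mult.assoc)

lemma ideal_span:
  fixes e :: "'i \<Rightarrow> 'a::idom"
  shows "ideal {\<Sum>k\<in>K. r k * e k |r. True} type_ring"
  unfolding ideal_type_ring_iff
proof (intro conjI ballI allI)
  show "0 \<in> {\<Sum>k\<in>K. r k * e k |r. True}" by (auto intro!: exI[of _ "\<lambda>_. 0"])
next
  fix u v assume "u \<in> {\<Sum>k\<in>K. r k * e k |r. True}" "v \<in> {\<Sum>k\<in>K. r k * e k |r. True}"
  then obtain r s where "u = (\<Sum>k\<in>K. r k * e k)" "v = (\<Sum>k\<in>K. s k * e k)" by blast
  then have "u + v = (\<Sum>k\<in>K. (r k + s k) * e k)" by (simp add: distrib_right sum.distrib)
  then show "u + v \<in> {\<Sum>k\<in>K. r k * e k |r. True}" by (auto intro: exI[of _ "\<lambda>k. r k + s k"])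
next
  fix u t assume "u \<in> {\<Sum>k\<in>K. r k * e k |r. True}"
  then obtain r where "u = (\<Sum>k\<in>K. r k * e k)" by blast
  then have "t * u = (\<Sum>k\<in>K. (t * r k) * e k)" by (simp add: sum_distrib_left mult.assoc)
  then show "t * u \<in> {\<Sum>k\<in>K. r k * e k |r. True}" by (auto intro: exI[of _ "\<lambda>k. t * r k"])
qed

text \<open>
  The relation says that \<open>x\<close> is a root of the monic polynomial \<open>t ^ n - \<Sum>k<n. r k * t ^ k\<close>.
\<close>

lemma integral_of_power_relation:
  fixes x :: "'a::idom fract"
  assumes "integrally_closed TYPE('a)"
    and rel: "x ^ n = (\<Sum>k<n. to_fract (r k) * x ^ k)"
  shows "x \<in> range to_fract"
proof -
  define g where "g = (\<Sum>k<n. Polynomial.monom (r k) k)"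
  define f where "f = Polynomial.monom 1 n - g"
  have coeff_g: "Polynomial.coeff g k = 0" if "n \<le> k" for k
    using that unfolding g_def by (auto simp: coeff_sum)
  have "Polynomial.coeff f n = 1" unfolding f_def using coeff_g by simp
  moreover have "Polynomial.degree f \<le> n"
    by (rule degree_le) (auto simp: f_def coeff_g)
  ultimately have "Polynomial.lead_coeff f = 1"
    by (metis le_antisym le_degree zero_neq_one)
  moreover have "poly (fract_poly f) x = 0"
  proof -
    have "fract_poly g = (\<Sum>k<n. Polynomial.monom (to_fract (r k)) k)"
      unfolding g_def by (induction n) (simp_all add: map_poly_monom)
    then have "poly (fract_poly f) x = x ^ n - (\<Sum>k<n. to_fract (r k) * x ^ k)"
      by (simp add: f_def map_poly_monom poly_monom poly_sum)
    then show ?thesis using rel by simp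
  qed
  ultimately show ?thesis using assms(1) unfolding integrally_closed_def by blast
qed

lemma to_fract_pow: "to_fract (x ^ n) = to_fract x ^ n"
  by (induction n) simp_all

text \<open>
  The hypothesis says that multiplication by the fraction \<open>x = b / a\<close> maps \<open>p\<close> to itself. Then all the
  elements \<open>e n = x ^ n * a\<close> lie in \<open>Z\<close>. The ideals generated by \<open>e 0, \<dots>, e (n - 1)\<close> become stationary,
  so \<open>x\<close> satisfies a monic equation and belongs to \<open>Z\<close>.
\<close>

lemma integrally_closed_dvd:
  fixes a b :: "'a::idom"
  assumes noeth: "noetherian_domain (type_ring :: 'a ring)"
    and closed: "integrally_closed TYPE('a)"
    and "a \<noteq> 0" "a \<in> p"
    and stable: "\<And>c. c \<in> p \<Longrightarrow> \<exists>c'\<in>p. b * c = a * c'"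
  shows "a dvd b"
proof -
  have "\<exists>e\<in>p. a ^ n * e = b ^ n * a" for n
  proof (induction n)
    case 0
    then show ?case using assms(4) by auto
  next
    case (Suc n)
    then obtain e where e: "e \<in> p" "a ^ n * e = b ^ n * a" by blast
    obtain e' where e': "e' \<in> p" "b * e = a * e'" using stable[OF e(1)] by blast
    have "a ^ Suc n * e' = a ^ n * (a * e')" by (simp add: algebra_simps)
    also have "\<dots> = b * (a ^ n * e)" by (simp add: e'(2)[symmetric] algebra_simps)
    also have "\<dots> = b ^ Suc n * a" by (simp add: e(2) mult.assoc)
    finally show ?case using e'(1) by blast
  qed
  then obtain e where e: "\<And>n. a ^ n * e n = b ^ n * a" by metis
  define x where "x = to_fract b / to_fract a"
  have ex: "to_fract (e n) = x ^ n * to_fract a" for n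
  proof -
    have "to_fract a ^ n * to_fract (e n) = to_fract b ^ n * to_fract a"
      using arg_cong[OF e[of n], of to_fract] by (simp add: to_fract_pow)
    then show ?thesis
      unfolding x_def power_divide using \<open>a \<noteq> 0\<close> by (simp add: field_simps)
  qed
  define J where "J n = {\<Sum>k<n. r k * e k |r. True}" for n
  have "\<exists>n. J (Suc n) = J n"
  proof (rule noetherian_ideal_sequence_stationary[OF noeth])
    show "ideal (J n) type_ring" for n unfolding J_def by (rule ideal_span)
    show "J n \<subseteq> J (Suc n)" for n
    proof
      fix u assume "u \<in> J n"
      then obtain r where "u = (\<Sum>k<n. r k * e k)" unfolding J_def by blast
      then have "u = (\<Sum>k<Suc n. (if k = n then 0 else r k) * e k)" by simp
      then show "u \<in> J (Suc n)"
        unfolding J_def by (intro CollectI exI[of _ "\<lambda>k. if k = n then 0 else r k"] conjI TrueI)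
    qed
  qed
  then obtain n where "J (Suc n) = J n" ..
  moreover have "e n \<in> J (Suc n)"
    unfolding J_def by (auto intro!: exI[of _ "\<lambda>k. if k = n then 1 else 0"])
  ultimately obtain r where r: "e n = (\<Sum>k<n. r k * e k)" unfolding J_def by blast
  have "x ^ n * to_fract a = (\<Sum>k<n. to_fract (r k) * x ^ k) * to_fract a"
    using arg_cong[OF r, of to_fract]
    by (simp add: to_fract_sum ex sum_distrib_right mult.assoc)
  then have "x ^ n = (\<Sum>k<n. to_fract (r k) * x ^ k)" using \<open>a \<noteq> 0\<close> by simp
  then obtain t where "x = to_fract t"
    using integral_of_power_relation[OF closed] by blast
  then have "to_fract b = to_fract (t * a)"
    unfolding x_def using \<open>a \<noteq> 0\<close> by (simp add: field_simps)
  then show ?thesis by (simp only: to_fract_eq_iff dvd_triv_right)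
qed

text \<open>
  The localization at such a prime is a discrete valuation ring. It is handled without being
  constructed: a property holds locally if it holds after multiplication by some \<open>s\<close> outside \<open>p\<close>.
\<close>

locale dedekind_prime =
  fixes p :: "'a::idom set"
  assumes dedekind: "dedekind_domain TYPE('a)"
    and prime: "primeideal p type_ring"
    and nonzero: "p \<noteq> {0}"
begin

lemma noeth: "noetherian_domain (type_ring :: 'a ring)"
  and maximal: "primeideal q type_ring \<Longrightarrow> q \<noteq> {0} \<Longrightarrow> maximalideal q (type_ring :: 'a ring)"
  and closed: "integrally_closed TYPE('a)"
  using dedekind unfolding dedekind_domain_def by auto

lemmas idl = primeideal_ideal[OF prime]
  and mult_notin = primeideal_mult_notin[OF prime]

text \<open>
  Among the ideals \<open>(a : b)\<close> contained in \<open>p\<close>, take a largest one, \<open>Q b\<close>. Replacing \<open>b\<close> by \<open>s * b\<close> with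
  \<open>s\<close> outside \<open>p\<close> does not change it, whereas multiplying \<open>b\<close> by an element outside \<open>Q b\<close> that is a zero
  divisor modulo \<open>Q b\<close> gives a larger ideal, which has to leave \<open>p\<close>. The two facts together make \<open>Q b\<close>
  prime. It is nonzero, hence maximal, hence equal to \<open>p\<close>.
\<close>

lemma prime_is_quotient:
  assumes "a \<in> p" "a \<noteq> 0"
  shows "\<exists>b. p = {x. a dvd x * b}"
proof -
  define Q where "Q b = {x. a dvd x * b}" for b
  have idlQ: "ideal (Q b) type_ring" for b unfolding Q_def by (rule ideal_quotient)
  have "Q 1 \<subseteq> p" using ideal_dvd[OF idl assms(1)] unfolding Q_def by auto
  then have "{Q b |b. Q b \<subseteq> p} \<noteq> {}" by blast
  then obtain M where M: "M \<in> {Q b |b. Q b \<subseteq> p}"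
    and M_max: "\<And>I. I \<in> {Q b |b. Q b \<subseteq> p} \<Longrightarrow> M \<subseteq> I \<Longrightarrow> I = M"
    by (rule noetherian_maximal_element[OF noeth]) (use idlQ in auto)
  then obtain b where "M = Q b" by auto
  with M M_max have b: "Q b \<subseteq> p"
    and max: "\<And>b'. Q b' \<subseteq> p \<Longrightarrow> Q b \<subseteq> Q b' \<Longrightarrow> Q b' = Q b"
    by auto
  have sub: "Q b \<subseteq> Q (s * b)" for s
    unfolding Q_def by (auto simp: mult.left_commute[of _ s] intro: dvd_mult)
  have cancel: "Q (s * b) = Q b" if "s \<notin> p" for s
  proof (rule max[OF _ sub])
    show "Q (s * b) \<subseteq> p"
    proof
      fix x assume "x \<in> Q (s * b)"
      then have "x * s \<in> Q b" unfolding Q_def by (simp add: mult.assoc)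
      then show "x \<in> p" using b that primeideal_multD[OF prime] by blast
    qed
  qed
  have "primeideal (Q b) type_ring"
    unfolding primeideal_type_ring_iff
  proof (intro conjI allI impI)
    show "1 \<notin> Q b" using b primeideal_one[OF prime] by blast
    fix x y assume xy: "x * y \<in> Q b"
    show "x \<in> Q b \<or> y \<in> Q b"
    proof (rule ccontr)
      assume notin: "\<not> (x \<in> Q b \<or> y \<in> Q b)"
      have y: "y \<in> Q (x * b)" using xy unfolding Q_def by (simp add: mult_ac)
      have "\<not> Q (x * b) \<subseteq> p" using max[OF _ sub] y notin by blast
      then obtain s where s: "s \<in> Q (x * b)" "s \<notin> p" by blast
      then have "x \<in> Q (s * b)" unfolding Q_def by (simp add: mult_ac)
      then show False using cancel[OF s(2)] notin by blast
    qed
  qed (rule idlQ)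
  moreover have "a \<in> Q b" unfolding Q_def by simp
  then have "Q b \<noteq> {0}" using assms(2) by blast
  ultimately have "maximalideal (Q b) type_ring" by (rule maximal)
  then interpret maximalideal "Q b" "type_ring :: 'a ring" .
  have "p = Q b"
    using I_maximal[OF idl b] primeideal_one[OF prime] by auto
  then show ?thesis unfolding Q_def by blast
qed

text \<open>
  With \<open>p = (a : b)\<close>, the fraction \<open>b / a\<close> maps \<open>p\<close> into \<open>Z\<close>. It cannot map \<open>p\<close> into \<open>p\<close>, as it would be
  integral and \<open>a\<close> would divide \<open>b\<close>. So it takes some \<open>c\<close> in \<open>p\<close> to some \<open>s\<close> outside \<open>p\<close>, and this \<open>c\<close>
  generates \<open>p\<close> locally.
\<close>

lemma exists_uniformizer: "\<exists>c\<in>p. \<exists>s. s \<notin> p \<and> (\<forall>x\<in>p. c dvd s * x)"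
proof -
  obtain a where a: "a \<in> p" "a \<noteq> 0" using nonzero ideal_zero[OF idl] by blast
  obtain b where b: "p = {x. a dvd x * b}" using prime_is_quotient[OF a] by blast
  have "\<not> a dvd b" using primeideal_one[OF prime] b by auto
  then have "\<not> (\<forall>c\<in>p. \<exists>c'\<in>p. b * c = a * c')"
    using integrally_closed_dvd[OF noeth closed a(2,1)] by blast
  then obtain c where c: "c \<in> p" "\<And>c'. b * c = a * c' \<Longrightarrow> c' \<notin> p" by blast
  have "a dvd b * c" using c(1) unfolding b by (simp add: mult.commute)
  then obtain s where s: "b * c = a * s" ..
  have "c dvd s * x" if "x \<in> p" for x
  proof -
    obtain x' where x': "x * b = a * x'" using \<open>x \<in> p\<close> b by (auto elim: dvdE)
    have "a * (s * x) = (b * c) * x" by (simp add: s mult.assoc)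
    also have "\<dots> = c * (x * b)" by (simp add: mult_ac)
    also have "\<dots> = a * (c * x')" unfolding x' by (simp only: mult_ac)
    finally have "s * x = c * x'" using a(2) by simp
    then show ?thesis by simp
  qed
  then show ?thesis using c s by blast
qed

definition uniformizer :: 'a where
  "uniformizer = (SOME c. c \<in> p \<and> (\<exists>s. s \<notin> p \<and> (\<forall>x\<in>p. c dvd s * x)))"

lemma uniformizer_in: "uniformizer \<in> p"
  and uniformizer_dvd: "\<exists>s. s \<notin> p \<and> (\<forall>x\<in>p. uniformizer dvd s * x)"
  using someI_ex[of "\<lambda>c. c \<in> p \<and> (\<exists>s. s \<notin> p \<and> (\<forall>x\<in>p. c dvd s * x))"] exists_uniformizer
  unfolding uniformizer_def by blast+

text \<open>
  Let \<open>J n\<close> be the local version of the ideal \<open>(w : c ^ n)\<close> for the uniformizer \<open>c\<close>. If \<open>c ^ Suc n\<close> divides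
  \<open>w\<close> locally, with quotient \<open>v\<close>, then \<open>v\<close> lies in \<open>J (Suc n)\<close>. If it also lay in \<open>J n\<close>, cancelling \<open>w\<close>
  would make \<open>c\<close> a divisor of an element outside \<open>p\<close>. So \<open>c ^ Suc n\<close> cannot divide \<open>w\<close> locally once the
  chain is stationary.
\<close>

lemma uniformizer_power_not_dvd:
  assumes "w \<noteq> 0"
  shows "\<exists>n. \<forall>s. s \<notin> p \<longrightarrow> \<not> uniformizer ^ n dvd s * w"
proof -
  let ?c = uniformizer
  define J where "J n = {y. \<exists>s. s \<notin> p \<and> w dvd s * ?c ^ n * y}" for n
  have "\<exists>n. J (Suc n) = J n"
  proof (rule noetherian_ideal_sequence_stationary[OF noeth])
    show "ideal (J n) type_ring" for n
      unfolding ideal_type_ring_iff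
    proof (intro conjI ballI allI)
      show "0 \<in> J n" unfolding J_def using primeideal_one[OF prime] by auto
    next
      fix y z assume "y \<in> J n" "z \<in> J n"
      then obtain s t where st: "s \<notin> p" "t \<notin> p" "w dvd s * ?c ^ n * y" "w dvd t * ?c ^ n * z"
        unfolding J_def by blast
      have "s * t * ?c ^ n * (y + z) = t * (s * ?c ^ n * y) + s * (t * ?c ^ n * z)"
        by (simp add: algebra_simps)
      then have "w dvd s * t * ?c ^ n * (y + z)" using st(3,4) by (metis dvd_add dvd_mult)
      then show "y + z \<in> J n" using mult_notin[OF st(1,2)] unfolding J_def by blast
    next
      fix y r assume "y \<in> J n"
      then obtain s where s: "s \<notin> p" "w dvd s * ?c ^ n * y" unfolding J_def by blast
      then have "w dvd s * ?c ^ n * (r * y)" by (metis dvd_mult mult.left_commute)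
      then show "r * y \<in> J n" using s(1) unfolding J_def by blast
    qed
    show "J n \<subseteq> J (Suc n)" for n
    proof
      fix y assume "y \<in> J n"
      then obtain s where s: "s \<notin> p" "w dvd s * ?c ^ n * y" unfolding J_def by blast
      have "s * ?c ^ Suc n * y = ?c * (s * ?c ^ n * y)" by (simp add: algebra_simps)
      then have "w dvd s * ?c ^ Suc n * y" using s(2) by (metis dvd_mult)
      then show "y \<in> J (Suc n)" using s(1) unfolding J_def by blast
    qed
  qed
  then obtain n where n: "J (Suc n) = J n" ..
  have "\<not> ?c ^ Suc n dvd s * w" if s: "s \<notin> p" for s
  proof
    assume "?c ^ Suc n dvd s * w"
    then obtain v where v: "s * w = ?c ^ Suc n * v" ..
    have "w dvd 1 * ?c ^ Suc n * v" by (metis v dvd_triv_right mult_1)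
    then have "v \<in> J (Suc n)"
      unfolding J_def using primeideal_one[OF prime] by (intro CollectI exI[of _ 1] conjI)
    then have "v \<in> J n" by (simp only: n)
    then obtain t where t: "t \<notin> p" "w dvd t * ?c ^ n * v" unfolding J_def by blast
    then obtain y where y: "t * ?c ^ n * v = w * y" by (auto elim: dvdE)
    have "w * (t * s) = t * (?c ^ Suc n * v)" unfolding v[symmetric] by (simp only: mult_ac)
    also have "\<dots> = ?c * (t * ?c ^ n * v)" by (simp add: mult_ac)
    also have "\<dots> = w * (?c * y)" unfolding y by (simp only: mult_ac)
    finally have "t * s = ?c * y" using assms by simp
    then have "t * s \<in> p" using ideal_mult'[OF idl uniformizer_in] by simp
    then show False using mult_notin[OF t(1) s] by blast
  qed
  then show ?thesis by blast
qed

text \<open>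
  The exponent \<open>n\<close> is the valuation of \<open>w\<close> at \<open>p\<close>.
\<close>

lemma local_factorization:
  assumes "w \<noteq> 0"
  shows "\<exists>n s u. s \<notin> p \<and> u \<notin> p \<and> s * w = uniformizer ^ n * u"
proof -
  let ?c = uniformizer
  define fails where "fails n \<longleftrightarrow> (\<forall>s. s \<notin> p \<longrightarrow> \<not> ?c ^ n dvd s * w)" for n
  have "\<exists>n. fails n" using uniformizer_power_not_dvd[OF assms] unfolding fails_def .
  moreover have "\<not> fails 0" using primeideal_one[OF prime] unfolding fails_def by auto
  ultimately obtain n where n: "fails (Suc n)" "\<not> fails n"
    using nat_induct[of "\<lambda>n. \<not> fails n"] by blast
  then obtain s where s: "s \<notin> p" "?c ^ n dvd s * w" unfolding fails_def by blast
  then obtain u where "s * w = ?c ^ n * u" by (auto elim: dvdE)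
  note su = s(1) this
  have "u \<notin> p"
  proof
    assume "u \<in> p"
    then obtain t u' where t: "t \<notin> p" "t * u = ?c * u'"
      using uniformizer_dvd by (meson dvdE)
    have "(t * s) * w = ?c ^ n * (t * u)" using su(2) by (simp add: mult_ac)
    also have "\<dots> = ?c ^ Suc n * u'" by (simp add: t(2) mult_ac)
    finally have "?c ^ Suc n dvd (t * s) * w" by (rule dvdI)
    then show False using n(1) mult_notin[OF t(1) su(1)] unfolding fails_def by blast
  qed
  with su show ?thesis by blast
qed

definition local_dvd :: "'a \<Rightarrow> 'a \<Rightarrow> bool" where
  "local_dvd x y \<longleftrightarrow> (\<exists>s. s \<notin> p \<and> x dvd s * y)"

lemma local_dvd_trans:
  assumes "local_dvd x y" "local_dvd y z"
  shows "local_dvd x z"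
proof -
  obtain s t where st: "s \<notin> p" "x dvd s * y" "t \<notin> p" "y dvd t * z"
    using assms unfolding local_dvd_def by auto
  have "s * y dvd s * (t * z)" using st(4) by (rule mult_dvd_mono[OF dvd_refl])
  then have "x dvd (s * t) * z" using st(2) by (metis dvd_trans mult.assoc)
  then show ?thesis unfolding local_dvd_def using mult_notin[OF st(1,3)] by auto
qed

text \<open>
  A nonzero element of least valuation does it.
\<close>

lemma exists_local_divisor_of_all:
  assumes "V \<noteq> {}" "V \<noteq> {0}"
  shows "\<exists>w\<in>V. w \<noteq> 0 \<and> (\<forall>v\<in>V. local_dvd w v)"
proof -
  let ?c = uniformizer
  obtain n s u where fac: "\<And>w. w \<noteq> 0 \<Longrightarrow> s w \<notin> p \<and> u w \<notin> p \<and> s w * w = ?c ^ n w * u w"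
    using local_factorization by metis
  obtain w0 where "w0 \<in> V" "w0 \<noteq> 0" using assms by blast
  then obtain w where w: "w \<in> V" "w \<noteq> 0" and min: "\<And>v. v \<in> V \<Longrightarrow> v \<noteq> 0 \<Longrightarrow> n w \<le> n v"
    using ex_has_least_nat[of "\<lambda>v. v \<in> V \<and> v \<noteq> 0" w0 n] by blast
  have "local_dvd w v" if "v \<in> V" for v
  proof (cases "v = 0")
    case True
    then show ?thesis unfolding local_dvd_def using primeideal_one[OF prime] by auto
  next
    case False
    have "u w * s v * v = u w * (?c ^ n v * u v)" using fac[OF False] by (simp add: mult.assoc)
    also have "?c ^ n v = ?c ^ n w * ?c ^ (n v - n w)"
      using min[OF that False] by (metis le_add_diff_inverse power_add)
    also have "u w * (?c ^ n w * ?c ^ (n v - n w) * u v) = (?c ^ n w * u w) * (?c ^ (n v - n w) * u v)"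
      by (simp add: mult_ac)
    also have "\<dots> = w * (s w * ?c ^ (n v - n w) * u v)"
      using fac[OF w(2)] by (metis mult.assoc mult.commute)
    finally have "w dvd u w * s v * v" by simp
    then show ?thesis
      unfolding local_dvd_def using fac[OF w(2)] fac[OF False] mult_notin by blast
  qed
  with w show ?thesis by blast
qed

text \<open>
  The element \<open>w * uniformizer\<close> has valuation one more than \<open>w\<close>, and \<open>q ^ N\<close> has valuation at least \<open>N\<close>.
\<close>

lemma local_dvd_power:
  assumes "w \<noteq> 0" "q \<in> p"
  shows "\<exists>N. local_dvd (w * uniformizer) (q ^ N)"
proof -
  let ?c = uniformizer
  obtain n s u where fac: "s \<notin> p" "u \<notin> p" "s * w = ?c ^ n * u"
    using local_factorization[OF assms(1)] by blast
  obtain t q' where t: "t \<notin> p" "t * q = ?c * q'"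
    using uniformizer_dvd assms(2) by (meson dvdE)
  have "u * t ^ Suc n * q ^ Suc n = u * (?c * q') ^ Suc n"
    unfolding t(2)[symmetric] power_mult_distrib by (simp only: mult.assoc)
  also have "\<dots> = (?c ^ n * u) * ?c * q' ^ Suc n" by (simp add: power_mult_distrib mult_ac)
  also have "\<dots> = w * ?c * (s * q' ^ Suc n)" unfolding fac(3)[symmetric] by (simp only: mult_ac)
  finally have "w * ?c dvd u * t ^ Suc n * q ^ Suc n" by simp
  then show ?thesis
    unfolding local_dvd_def
    using mult_notin[OF fac(2) primeideal_power_notin[OF prime t(1)]] by blast
qed

text \<open>
  If \<open>q ^ N\<close> is locally a multiple of \<open>w * uniformizer\<close>, where \<open>w\<close> is the value at \<open>m\<close>, then the value
  at \<open>m + q ^ N * y\<close> is \<open>w\<close> times an element that is locally congruent to \<open>1\<close> modulo \<open>p\<close>, so it has the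
  same valuation as \<open>w\<close>.
\<close>

lemma local_dvd_perturbed_value:
  assumes "poly f m \<noteq> 0" "q \<in> p"
  shows "\<exists>N. \<forall>y. poly f (m + q ^ N * y) \<noteq> 0 \<and> local_dvd (poly f (m + q ^ N * y)) (poly f m)"
proof -
  define w where "w = poly f m"
  obtain N where "local_dvd (w * uniformizer) (q ^ N)"
    using local_dvd_power assms unfolding w_def by blast
  then obtain s where s: "s \<notin> p" "w * uniformizer dvd s * q ^ N" unfolding local_dvd_def by blast
  have "poly f (m + q ^ N * y) \<noteq> 0 \<and> local_dvd (poly f (m + q ^ N * y)) w" for y
  proof -
    let ?v = "poly f (m + q ^ N * y)"
    have "q ^ N * y dvd ?v - w"
      using poly_diff_dvd[of "m + q ^ N * y" m f] unfolding w_def by simp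
    then have "q ^ N dvd ?v - w" by (rule dvd_mult_left)
    then have "w * uniformizer dvd s * (?v - w)"
      using s(2) by (metis dvd_trans mult_dvd_mono dvd_refl)
    then obtain k where k: "s * (?v - w) = w * uniformizer * k" ..
    then have eq: "s * ?v = w * (s + uniformizer * k)" by (simp add: algebra_simps)
    have "s + uniformizer * k \<notin> p"
      using s(1) ideal_mult'[OF idl uniformizer_in, of k] ideal_diff[OF idl]
      by (metis add_diff_cancel_right')
    \<comment> \<open>The factor \<open>s + uniformizer * k\<close> outside \<open>p\<close> serves as the local multiplier.\<close>
    moreover have "?v dvd (s + uniformizer * k) * w" using eq by (metis dvd_triv_right mult.commute)
    moreover have "s + uniformizer * k \<noteq> 0"
      using calculation(1) ideal_zero[OF idl] by metis
    then have "?v \<noteq> 0" using eq assms(1) unfolding w_def by auto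
    ultimately show ?thesis unfolding local_dvd_def by blast
  qed
  then show ?thesis unfolding w_def by blast
qed

end

text \<open>
  A prime ideal may contain all values of the polynomials even if no nonunit element divides them all,
  so the notion of a good point is finer here: one of the values at the point must divide, locally at
  \<open>p\<close>, every value of every \<open>P i\<close>. At a point that is good at all primes containing \<open>\<delta>\<close>, a common divisor
  \<open>d\<close> of the values divides each value \<open>v\<close> of each \<open>P i\<close> locally at these primes. As \<open>d\<close> divides \<open>\<delta>\<close>,
  the ideal \<open>(d : v)\<close> contains \<open>\<delta>\<close>, so it is contained in no prime ideal and \<open>d\<close> divides \<open>v\<close>. Hence \<open>d\<close>
  is a unit by the hypothesis on divisors.
\<close>

proposition dedekind_coprime_values:
  fixes P :: "'i \<Rightarrow> 'a::idom poly"
  assumes dedekind: "dedekind_domain TYPE('a)"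
    and "\<delta> \<noteq> 0" and bezout: "(\<Sum>i\<in>J. A i * P i) = [:\<delta>:]"
    and no_divisor: "\<And>a. (\<And>i z. i \<in> J \<Longrightarrow> a dvd poly (P i) z) \<Longrightarrow> a dvd 1"
  shows "\<exists>m. setwise_coprime ((\<lambda>i. poly (P i) m) ` J)"
proof -
  define V where "V = {poly (P i) z |i z. i \<in> J}"
  define S where "S = {p. primeideal p type_ring \<and> \<delta> \<in> p}"
  define G where "G p = {m. \<exists>i\<in>J. poly (P i) m \<noteq> 0 \<and>
    (\<forall>v\<in>V. dedekind_prime.local_dvd p (poly (P i) m) v)}" for p
  have S_maximal: "maximalideal p (type_ring :: 'a ring)" if "p \<in> S" for p
    using dedekind that \<open>\<delta> \<noteq> 0\<close> unfolding dedekind_domain_def S_def by auto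
  have noeth: "noetherian_domain (type_ring :: 'a ring)"
    using dedekind unfolding dedekind_domain_def by blast
  have S_prime: "dedekind_prime p" if "p \<in> S" for p
    using dedekind that \<open>\<delta> \<noteq> 0\<close> unfolding S_def by (intro dedekind_prime.intro) auto
  have incomparable: "p = q" if "p \<in> S" "q \<in> S" "p \<subseteq> q" for p q
  proof -
    interpret maximalideal p "type_ring :: 'a ring" using S_maximal that(1) .
    have "primeideal q type_ring" using that(2) unfolding S_def by blast
    then show ?thesis
      using I_maximal[of q] that(3) primeideal_ideal primeideal_one by auto
  qed
  \<comment> \<open>Otherwise \<open>0\<close>, which is not a unit, would divide all values.\<close>
  have "\<not> (\<forall>v\<in>V. v = 0)"
  proof
    assume "\<forall>v\<in>V. v = 0"
    then have "0 dvd (1::'a)" using no_divisor[of 0] unfolding V_def by auto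
    then show False by simp
  qed
  then have V: "V \<noteq> {}" "V \<noteq> {0}" by auto
  have stable: "\<exists>N. \<forall>y. m + b ^ N * y \<in> G p" if "p \<in> S" "m \<in> G p" "b \<in> p" for p m b
  proof -
    interpret dedekind_prime p using S_prime that(1) .
    obtain i where i: "i \<in> J" "poly (P i) m \<noteq> 0" "\<And>v. v \<in> V \<Longrightarrow> local_dvd (poly (P i) m) v"
      using \<open>m \<in> G p\<close> unfolding G_def by blast
    then show ?thesis
      using local_dvd_perturbed_value[OF i(2) that(3)] local_dvd_trans unfolding G_def by blast
  qed
  have "\<exists>m. \<forall>p\<in>S. m \<in> G p"
  proof (rule simultaneous_point)
    \<comment> \<open>The principal ideal of \<open>\<delta>\<close>, written as the quotient \<open>(\<delta> : 1)\<close>.\<close>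
    define I where "I = {x. \<delta> dvd x * 1}"
    have "ideal I type_ring" unfolding I_def by (rule ideal_quotient)
    then obtain F where F: "finite F" "\<And>q. q \<in> F \<Longrightarrow> primeideal q type_ring \<and> I \<subseteq> q"
      "\<And>p. primeideal p type_ring \<Longrightarrow> I \<subseteq> p \<Longrightarrow> \<exists>q\<in>F. q \<subseteq> p"
      using noetherian_finite_primes_below[OF noeth] by metis
    have "S \<subseteq> F"
    proof
      fix p assume p: "p \<in> S"
      then have pp: "primeideal p type_ring" "\<delta> \<in> p" unfolding S_def by auto
      then have "I \<subseteq> p" using ideal_dvd[OF primeideal_ideal] unfolding I_def by auto
      then obtain q where q: "q \<in> F" "q \<subseteq> p" using F(3) pp by blast
      have "\<delta> \<in> I" unfolding I_def by simp
      then have "q \<in> S" using F(2)[OF q(1)] unfolding S_def by auto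
      then show "p \<in> F" using incomparable[of q p] p q by simp
    qed
    then show "finite S" using F(1) by (rule finite_subset)
    show "\<exists>y. m + b * y \<in> G p" if p: "p \<in> S" and b: "b \<notin> p" for p m b
    proof -
      interpret dedekind_prime p using S_prime p .
      obtain r where r: "1 - b * r \<in> p"
        using maximalideal_inverse_mod[OF S_maximal[OF p] b] ..
      obtain w where w: "w \<in> V" "w \<noteq> 0" "\<forall>v\<in>V. local_dvd w v"
        using exists_local_divisor_of_all[OF V] by auto
      then obtain i z where "i \<in> J" "w = poly (P i) z" unfolding V_def by auto
      with w have "z \<in> G p" unfolding G_def by auto
      then show ?thesis using stable[OF p] by (rule dense_of_inverse_mod[OF idl r])
    qed
    show "primeideal p type_ring" if "p \<in> S" for p using that unfolding S_def by simp
  qed (fact incomparable stable)+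
  then obtain m where m: "\<And>p. p \<in> S \<Longrightarrow> m \<in> G p" by blast
  have "setwise_coprime ((\<lambda>i. poly (P i) m) ` J)"
    unfolding setwise_coprime_def
  proof (intro allI impI)
    fix d assume d: "\<forall>v\<in>(\<lambda>i. poly (P i) m) ` J. d dvd v"
    have "\<delta> = (\<Sum>i\<in>J. poly (A i) m * poly (P i) m)"
      using arg_cong[OF bezout, of "\<lambda>f. poly f m"] by (simp add: poly_sum)
    then have "d dvd \<delta>" using d by (simp add: dvd_sum)
    have "d dvd v" if "v \<in> V" for v
    proof (rule ccontr)
      assume "\<not> d dvd v"
      let ?Q = "{x. d dvd x * v}"
      have "1 \<notin> ?Q" using \<open>\<not> d dvd v\<close> by simp
      then obtain p where p: "primeideal p type_ring" "?Q \<subseteq> p"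
        using noetherian_proper_ideal_in_primeideal[OF noeth ideal_quotient] by blast
      then have "p \<in> S" using \<open>d dvd \<delta>\<close> unfolding S_def by auto
      interpret dedekind_prime p using S_prime \<open>p \<in> S\<close> .
      obtain i where i: "i \<in> J" "local_dvd (poly (P i) m) v"
        using m[OF \<open>p \<in> S\<close>] \<open>v \<in> V\<close> unfolding G_def by blast
      then obtain s where s: "s \<notin> p" "poly (P i) m dvd s * v" unfolding local_dvd_def by blast
      then have "s \<in> ?Q" using d i(1) by (auto intro: dvd_trans)
      with p(2) s(1) show False by blast
    qed
    then show "d dvd 1" using no_divisor[of d] unfolding V_def by blast
  qed
  then show ?thesis ..
qed

section \<open>Coprime values\<close>

theorem theorem1p3:
  fixes P :: "nat \<Rightarrow> 'z::idom poly" and l :: nat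
  assumes "unique_factorization_domain TYPE('z) \<or> dedekind_domain TYPE('z)"
    and "l \<ge> 2"
    and "\<And>i. i \<in> {1..l} \<Longrightarrow> P i \<noteq> 0"
    and "setwise_coprime ((\<lambda>i. fract_poly (P i)) ` {1..l})"
    and "\<not> (\<exists>a::'z. \<not> a dvd 1 \<and> (\<forall>i\<in>{1..l}. \<forall>z. a dvd poly (P i) z))"
  shows "\<exists>m::'z. setwise_coprime ((\<lambda>i. poly (P i) m) ` {1..l})"
proof -
  have "1 \<in> {1..l}" using assms(2) by simp
  then have "P 1 \<noteq> 0" by (rule assms(3))
  then obtain A \<delta> where bezout: "\<delta> \<noteq> 0" "(\<Sum>i\<in>{1..l}. A i * P i) = [:\<delta>:]"
    using coprime_polys_nonzero_constant[OF finite_atLeastAtMost \<open>1 \<in> {1..l}\<close> _ assms(4)] by metis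
  have no_divisor: "a dvd 1" if "\<And>i z. i \<in> {1..l} \<Longrightarrow> a dvd poly (P i) z" for a
    using assms(5) that by auto
  from assms(1) show ?thesis
  proof
    assume "unique_factorization_domain TYPE('z)"
    then show ?thesis using bezout no_divisor by (rule ufd_coprime_values)
  next
    assume "dedekind_domain TYPE('z)"
    then show ?thesis using bezout no_divisor by (rule dedekind_coprime_values)
  qed
qed

end
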